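(* Let $d\ge 1$, $r=2^d$, and place the $r$ thieves bijectively at the vertices of the $d$-dimensional cube. Let a (discrete, unclasped) necklace consist of beads of $n$ kinds, with $ra_i$ beads of kind $i$ for each $i\in[n]$. Then there always exists a binary necklace splitting with $(r-1)n$ cuts: a fair splitting of the necklace by $(r-1)n$ cuts into $(r-1)n+1$ consecutive (possibly empty) pieces, allocated to the thieves so that each thief receives exactly $a_i$ beads of kind $i$ for every $i$, and such that any two consecutive pieces are allocated either to the same thief or to two thieves whose vertices share an edge of the cube.
   Context: Cuts are made in the gaps between consecutive beads (several cuts may be made at the same gap, producing empty pieces); the pieces are linearly ordered along the necklace, so each piece has at most two neighbours. *)

theory Defs
  imports Main
begin

definition cube_vertices :: "nat \<Rightarrow> bool list set" where
  "cube_vertices d = {v. length v = d}"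

definition cube_edge :: "nat \<Rightarrow> bool list \<Rightarrow> bool list \<Rightarrow> bool" where
  "cube_edge d u v \<longleftrightarrow>
     u \<in> cube_vertices d \<and> v \<in> cube_vertices d \<and> card {k. k < d \<and> u ! k \<noteq> v ! k} = 1"

text \<open>
  An open necklace is the list of the kinds of its beads. The gap \<open>p\<close> lies between the
  first \<open>p\<close> beads and the rest, so the gaps between consecutive beads are those with
  \<open>0 < p < length w\<close>. The necklace without beads has no such gap; by convention its single
  position 0 counts as a gap, so that it can be cut into empty pieces.
\<close>

definition gaps :: "'k list \<Rightarrow> nat set" where
  "gaps w = (if w = [] then {0} else {0<..<length w})"

text \<open>
  The cuts are given as a weakly increasing list of gaps: \<open>length cs\<close> cuts produce the pieces
  numbered from 0 to \<open>length cs\<close>, and a repeated entry produces an empty piece.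
\<close>

definition piece :: "'k list \<Rightarrow> nat list \<Rightarrow> nat \<Rightarrow> 'k list" where
  "piece w cs j =
     (let e = 0 # cs @ [length w] in take (e ! Suc j - e ! j) (drop (e ! j) w))"

text \<open>The piece \<open>j\<close> is allocated to the thief \<open>al ! j\<close>.\<close>

definition necklace_splitting :: "'k list \<Rightarrow> 't set \<Rightarrow> nat list \<Rightarrow> 't list \<Rightarrow> bool" where
  "necklace_splitting w T cs al \<longleftrightarrow>
     sorted cs \<and> set cs \<subseteq> gaps w \<and> length al = length cs + 1 \<and> set al \<subseteq> T"

definition beads_received :: "'k list \<Rightarrow> nat list \<Rightarrow> 't list \<Rightarrow> 't \<Rightarrow> 'k \<Rightarrow> nat" where
  "beads_received w cs al t i =
     (\<Sum>j | j \<le> length cs \<and> al ! j = t. count_list (piece w cs j) i)"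

definition fair_splitting ::
  "'k list \<Rightarrow> 'k set \<Rightarrow> ('k \<Rightarrow> nat) \<Rightarrow> 't set \<Rightarrow> nat list \<Rightarrow> 't list \<Rightarrow> bool" where
  "fair_splitting w K a T cs al \<longleftrightarrow>
     necklace_splitting w T cs al \<and> (\<forall>t\<in>T. \<forall>i\<in>K. beads_received w cs al t i = a i)"

definition binary_allocation :: "nat \<Rightarrow> ('t \<Rightarrow> bool list) \<Rightarrow> 't list \<Rightarrow> bool" where
  "binary_allocation d place al \<longleftrightarrow>
     (\<forall>j. Suc j < length al \<longrightarrow>
        al ! j = al ! Suc j \<or> cube_edge d (place (al ! j)) (place (al ! Suc j)))"

end

theory Submission
  imports Defs "HOL-Combinatorics.Transposition"
begin

text \<open>
  Distribute the beads in \<open>d\<close> rounds, round \<open>k\<close> choosing coordinate \<open>k\<close> of the vertex that receives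
  each bead. Once the first \<open>k\<close> coordinates are chosen, count beads as being of the same new kind if
  they agree in their old kind and in these coordinates: a fair halving of the resulting
  \<open>2 ^ k * n\<close> kinds changes the next coordinate at most \<open>2 ^ k * n\<close> times along the necklace. The
  changes of all coordinates add up to \<open>(2 ^ d - 1) * n\<close>, and if several coordinates change at the
  same gap, then they are flipped one at a time, which costs only empty pieces.

  A halving with as many cuts as kinds is found by a parity count. Let the number of beads of every
  kind be odd, and consider the sets \<open>T\<close> that contain one bead of each kind such that, if every bead of
  \<open>T\<close> is cut in the middle and the thieves alternate, all the uncut beads are shared equally. The
  number of such \<open>T\<close> is odd: it is 1 if the kinds form contiguous blocks, and its parity does not
  change when two adjacent beads are swapped. For even numbers, append one more bead of each kind.
\<close>

subsection \<open>Invariance under swapping adjacent beads\<close>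

definition alt_sign :: "nat set \<Rightarrow> nat \<Rightarrow> int" where
  "alt_sign T j = (- 1) ^ card {t \<in> T. t < j}"

text \<open>The excluded beads \<open>Z\<close> and the signs \<open>s\<close> are separate
  parameters because the arguments below change the signs while the set of counted beads stays
  fixed.\<close>

definition imbalance :: "(nat \<Rightarrow> 'k) \<Rightarrow> nat \<Rightarrow> nat set \<Rightarrow> (nat \<Rightarrow> int) \<Rightarrow> 'k \<Rightarrow> int" where
  "imbalance f N Z s c = (\<Sum>j | j < N \<and> f j = c \<and> j \<notin> Z. s j)"

definition halving :: "(nat \<Rightarrow> 'k) \<Rightarrow> nat \<Rightarrow> 'k set \<Rightarrow> nat set \<Rightarrow> bool" where
  "halving f N K T \<longleftrightarrow> T \<subseteq> {..<N} \<and> bij_betw f T K \<and> (\<forall>c\<in>K. imbalance f N T (alt_sign T) c = 0)"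

text \<open>For adjacent beads \<open>x\<close> and \<open>y = x + 1\<close> that are to be swapped: both are ignored, but the necklace
  is cut between them. As neither is counted, putting \<open>x\<close> into the cut set expresses this cut.\<close>

definition nearly_balanced ::
  "(nat \<Rightarrow> 'k) \<Rightarrow> nat \<Rightarrow> 'k set \<Rightarrow> nat \<Rightarrow> nat \<Rightarrow> nat set \<Rightarrow> 'k \<Rightarrow> bool" where
  "nearly_balanced f N K x y V e \<longleftrightarrow>
     (\<forall>c\<in>K. \<bar>imbalance f N (V \<union> {x, y}) (alt_sign (insert x V)) c\<bar> = (if c = e then 1 else 0))"

section \<open>Elementary facts on signs and imbalances\<close>

lemma alt_sign_cases: "alt_sign T j = 1 \<or> alt_sign T j = - 1"
  unfolding alt_sign_def by (cases "even (card {t \<in> T. t < j})") auto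

lemma alt_sign_insert:
  assumes "finite T" and "v \<notin> T"
  shows "alt_sign (insert v T) j = (if v < j then - alt_sign T j else alt_sign T j)"
proof -
  have "{t \<in> insert v T. t < j} = (if v < j then insert v {t \<in> T. t < j} else {t \<in> T. t < j})"
    by auto
  then show ?thesis
    using assms by (auto simp: alt_sign_def)
qed

lemma imbalance_cong:
  assumes "\<And>j. j < N \<Longrightarrow> f j = c \<Longrightarrow> j \<notin> Z \<Longrightarrow> s j = s' j"
  shows "imbalance f N Z s c = imbalance f N Z s' c"
  unfolding imbalance_def by (rule sum.cong) (use assms in auto)

lemma imbalance_split:
  assumes "v < N" and "v \<notin> Z"
  shows "imbalance f N Z s c = imbalance f N (insert v Z) s c + (if c = f v then s v else 0)"
proof (cases "c = f v")
  case True
  have "{j. j < N \<and> f j = c \<and> j \<notin> Z} = insert v {j. j < N \<and> f j = c \<and> j \<notin> insert v Z}"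
    using True assms by auto
  then show ?thesis
    using True by (simp add: imbalance_def)
next
  case False
  then have "{j. j < N \<and> f j = c \<and> j \<notin> Z} = {j. j < N \<and> f j = c \<and> j \<notin> insert v Z}"
    by auto
  then show ?thesis
    using False by (simp add: imbalance_def)
qed

lemma imbalance_minus: "imbalance f N Z (\<lambda>j. - s j) c = - imbalance f N Z s c"
  by (simp add: imbalance_def sum_negf)

text \<open>Here a bead of kind \<open>e\<close> changes its sign, and \<open>R\<close> is the
  imbalance of all other beads. The two balance conditions exclude each other, as they require
  \<open>R e\<close> to be \<sigma> and - \<sigma>; so they differ iff one of them holds.\<close>

lemma all_zero_toggle:
  fixes R :: "'k \<Rightarrow> int"
  assumes \<sigma>: "\<sigma> = 1 \<or> \<sigma> = - 1" and e: "e \<in> K"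
  shows "(\<forall>c\<in>K. R c - (if c = e then \<sigma> else 0) = 0) \<noteq> (\<forall>c\<in>K. R c + (if c = e then \<sigma> else 0) = 0) \<longleftrightarrow>
    (\<forall>c\<in>K. \<bar>R c\<bar> = (if c = e then 1 else 0))"
proof -
  have K: "(\<forall>c\<in>K. P c) \<longleftrightarrow> P e \<and> (\<forall>c\<in>K - {e}. P c)" for P
    using e by auto
  have "(\<forall>c\<in>K. R c - (if c = e then \<sigma> else 0) = 0) \<longleftrightarrow> R e = \<sigma> \<and> (\<forall>c\<in>K - {e}. R c = 0)"
    by (subst K) auto
  moreover have "(\<forall>c\<in>K. R c + (if c = e then \<sigma> else 0) = 0) \<longleftrightarrow> R e = - \<sigma> \<and> (\<forall>c\<in>K - {e}. R c = 0)"
    by (subst K) auto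
  moreover have "(\<forall>c\<in>K. \<bar>R c\<bar> = (if c = e then 1 else 0)) \<longleftrightarrow> \<bar>R e\<bar> = 1 \<and> (\<forall>c\<in>K - {e}. R c = 0)"
    by (subst K) auto
  moreover have "(R e = \<sigma>) \<noteq> (R e = - \<sigma>) \<longleftrightarrow> \<bar>R e\<bar> = 1"
    using \<sigma> by auto
  ultimately show ?thesis
    by blast
qed

lemma even_card_changes:
  fixes h :: "nat \<Rightarrow> bool"
  assumes "h 0 = h N"
  shows "even (card {v. v < N \<and> h v \<noteq> h (Suc v)})"
proof -
  have "even (card {v. v < m \<and> h v \<noteq> h (Suc v)}) \<longleftrightarrow> h 0 = h m" for m
  proof (induction m)
    case (Suc m)
    have "{v. v < Suc m \<and> h v \<noteq> h (Suc v)} =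
        (if h m \<noteq> h (Suc m) then insert m {v. v < m \<and> h v \<noteq> h (Suc v)}
         else {v. v < m \<and> h v \<noteq> h (Suc v)})"
      by (auto simp: less_Suc_eq)
    then show ?case
      using Suc by auto
  qed simp
  then show ?thesis
    using assms by simp
qed

text \<open>Let one more cut travel through all gaps of the necklace. The property that every kind is
  balanced has the same truth value at both ends, so it changes an even number of times; it changes
  exactly when the cut passes one of the beads \<open>v\<close> counted here.\<close>

lemma even_card_nearly_balanced:
  assumes U: "U \<subseteq> {..<N} - {x, y}" and x: "x < N"
  shows "even (card {v. v < N \<and> v \<notin> U \<union> {x, y} \<and> f v \<in> K \<and> nearly_balanced f N K x y (insert v U) (f v)})"
proof -
  define C where "C = insert x U"
  define Z where "Z = U \<union> {x, y}"
  \<comment> \<open>\<open>s g\<close> gives the signs when the travelling cut lies just in front of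
    bead \<open>g\<close>: all beads from \<open>g\<close> on change sides. Hence \<open>s 0\<close>
    and \<open>s N\<close> are opposite on the whole necklace, which makes \<open>h 0\<close> and
    \<open>h N\<close> equivalent.\<close>
  define s where "s g j = (if g \<le> j then - alt_sign C j else alt_sign C j)" for g j
  define h where "h g \<longleftrightarrow> (\<forall>c\<in>K. imbalance f N Z (s g) c = 0)" for g
  have fin: "finite C"
    using U unfolding C_def by (auto intro: finite_subset)
  have "imbalance f N Z (s 0) c = - imbalance f N Z (s N) c" for c
    unfolding imbalance_minus [symmetric] by (rule imbalance_cong) (auto simp: s_def)
  then have h: "h 0 = h N"
    by (simp add: h_def)
  have same: "imbalance f N Z (s v) c = imbalance f N Z (s (Suc v)) c" if "v \<in> Z \<or> f v \<noteq> c" for v c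
    by (rule imbalance_cong) (use that in \<open>auto simp: s_def le_less_Suc_eq Suc_le_eq order_le_less\<close>)
  have "h v \<noteq> h (Suc v) \<longleftrightarrow>
      v \<notin> Z \<and> f v \<in> K \<and> nearly_balanced f N K x y (insert v U) (f v)" if v: "v < N" for v
  proof (cases "v \<in> Z \<or> f v \<notin> K")
    case True
    then have "h v = h (Suc v)"
      unfolding h_def using same by metis
    then show ?thesis
      using True by auto
  next
    case False
    let ?R = "imbalance f N (insert v Z) (alt_sign (insert v C))"
    have vC: "v \<notin> C"
      using False by (auto simp: C_def Z_def)
    \<comment> \<open>As long as \<open>v\<close> is not counted, a cut in front of
      \<open>v\<close>, behind it or through it gives the same signs. Thus \<open>h v\<close> and
      \<open>h (Suc v)\<close> differ only in the sign of \<open>v\<close> itself.\<close>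
    have "imbalance f N (insert v Z) (s v) c = ?R c" for c
      by (rule imbalance_cong) (auto simp: s_def alt_sign_insert [OF fin vC])
    moreover have "imbalance f N (insert v Z) (s (Suc v)) c = ?R c" for c
      by (rule imbalance_cong) (auto simp: s_def alt_sign_insert [OF fin vC])
    ultimately have R: "imbalance f N Z (s v) c = ?R c - (if c = f v then alt_sign C v else 0)"
      "imbalance f N Z (s (Suc v)) c = ?R c + (if c = f v then alt_sign C v else 0)" for c
      using False v by (simp_all add: imbalance_split [of v N Z] s_def)
    have "h v \<noteq> h (Suc v) \<longleftrightarrow> (\<forall>c\<in>K. \<bar>?R c\<bar> = (if c = f v then 1 else 0))"
      unfolding h_def R using False alt_sign_cases by (intro all_zero_toggle) auto
    moreover have "insert v Z = insert v U \<union> {x, y}" "insert v C = insert x (insert v U)"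
      by (auto simp: Z_def C_def)
    ultimately show ?thesis
      using False by (simp add: nearly_balanced_def)
  qed
  then have "{v. v < N \<and> h v \<noteq> h (Suc v)} =
      {v. v < N \<and> v \<notin> U \<union> {x, y} \<and> f v \<in> K \<and> nearly_balanced f N K x y (insert v U) (f v)}"
    unfolding Z_def by blast
  then show ?thesis
    using even_card_changes [OF h] by simp
qed

text \<open>If the kind of some \<open>v\<close> in \<open>W\<close> is \<open>A\<close> or
  \<open>B\<close>, then \<open>V\<close> is a transversal of \<open>K\<close> without the other of
  the two kinds, and \<open>v\<close> is the only member of \<open>W\<close>. Otherwise the kind of
  \<open>v\<close> occurs exactly twice in \<open>V\<close>; both beads of that kind can be removed,
  and \<open>Q\<close> treats them alike, so \<open>W\<close> has two members. Thus \<open>W\<close>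
  is odd exactly in the first case.\<close>

lemma odd_card_removable:
  fixes f :: "'a \<Rightarrow> 'k" and Q :: "'k \<Rightarrow> bool"
  assumes V: "finite V" and AB: "A \<in> K" "B \<in> K" "A \<noteq> B"
  defines "W \<equiv> {v \<in> V. bij_betw f (V - {v}) (K - {A, B}) \<and> f v \<in> K \<and> Q (f v)}"
  shows "odd (card W) \<longleftrightarrow> bij_betw f V (K - {A}) \<and> Q B \<or> bij_betw f V (K - {B}) \<and> Q A"
proof -
  have ins: "bij_betw f V (insert (f v) L) \<longleftrightarrow> bij_betw f (V - {v}) L" if "v \<in> V" "f v \<notin> L" for v L
    using that notIn_Un_bij_betw3 [of v "V - {v}" f L] by (simp add: insert_absorb)
  have ex: "bij_betw f V (insert e (K - {A, B})) \<and> Q e \<longleftrightarrow> (\<exists>v\<in>W. f v = e)"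
    if e: "e \<in> {A, B}" for e
  proof
    assume *: "bij_betw f V (insert e (K - {A, B})) \<and> Q e"
    then obtain v where v: "v \<in> V" "f v = e"
      by (metis bij_betw_imp_surj_on imageE insertI1)
    then have "bij_betw f (V - {v}) (K - {A, B})"
      using * ins [of v "K - {A, B}"] e by simp
    then show "\<exists>v\<in>W. f v = e"
      using * v e AB by (auto simp: W_def)
  next
    assume "\<exists>v\<in>W. f v = e"
    then obtain v where "v \<in> W" "f v = e" ..
    then show "bij_betw f V (insert e (K - {A, B})) \<and> Q e"
      using ins [of v "K - {A, B}"] e by (simp add: W_def)
  qed
  have K: "K - {A} = insert B (K - {A, B})" "K - {B} = insert A (K - {A, B})"
    using AB by auto
  have "odd (card W) \<longleftrightarrow> (\<exists>v\<in>W. f v \<in> {A, B})"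
  proof (cases "\<exists>v\<in>W. f v \<in> {A, B}")
    case True
    then obtain v where v: "v \<in> W" "f v \<in> {A, B}" ..
    have "v' = v" if "v' \<in> W" for v'
    proof (rule ccontr)
      assume "v' \<noteq> v"
      then have "f v \<in> f ` (V - {v'})"
        using v by (auto simp: W_def)
      moreover have "f ` (V - {v'}) = K - {A, B}"
        using that by (simp add: W_def bij_betw_def)
      ultimately show False
        using v by simp
    qed
    then have "W = {v}"
      using v by blast
    then show ?thesis
      using v by simp
  next
    case False
    show ?thesis
    proof (cases "W = {}")
      case False
      then obtain v where v: "v \<in> W"
        by auto
      then have bij: "bij_betw f (V - {v}) (K - {A, B})" and fv: "f v \<in> K - {A, B}"
        using \<open>\<not> (\<exists>v\<in>W. f v \<in> {A, B})\<close> by (auto simp: W_def)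
      then have "f v \<in> f ` (V - {v})"
        by (simp add: bij_betw_imp_surj_on)
      then obtain v' where v': "v' \<in> V - {v}" "f v = f v'" ..
      then have v': "v' \<in> V" "v' \<noteq> v" "f v' = f v"
        by auto
      have "bij_betw f (V - {v} - {v'}) (K - {A, B} - {f v})"
        using bij_betw_DiffI [OF bij, of "{v'}" "{f v}"] v' fv by auto
      then have "bij_betw f (insert v (V - {v} - {v'})) (insert (f v) (K - {A, B} - {f v}))"
        using notIn_Un_bij_betw [of v "V - {v} - {v'}" f "K - {A, B} - {f v}"] by simp
      moreover have "insert v (V - {v} - {v'}) = V - {v'}"
        using v v' by (auto simp: W_def)
      moreover have "insert (f v) (K - {A, B} - {f v}) = K - {A, B}"
        using fv by blast
      ultimately have "v' \<in> W"
        using v v' by (simp add: W_def)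
      moreover have "u = v \<or> u = v'" if "u \<in> W" for u
      proof (rule ccontr)
        assume "\<not> (u = v \<or> u = v')"
        then have "v \<in> V - {u}" "v' \<in> V - {u}"
          using v v' by (auto simp: W_def)
        moreover have "inj_on f (V - {u})"
          using that by (simp add: W_def bij_betw_def)
        ultimately show False
          using v' by (metis inj_onD)
      qed
      ultimately have "W = {v, v'}"
        using v by blast
      then show ?thesis
        using v' \<open>\<not> (\<exists>v\<in>W. f v \<in> {A, B})\<close> by simp
    qed simp
  qed
  then show ?thesis
    unfolding K using ex by auto
qed

text \<open>Double counting of the pairs of a set \<open>V\<close> and a removable bead
  \<open>v\<close> in it. For fixed \<open>U = V - {v}\<close> the number of possible
  \<open>v\<close> is even, by the travelling cut; for fixed \<open>V\<close> it is odd exactly when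
  \<open>V\<close> is one of the sets counted here.\<close>

lemma even_card_swap_defects:
  assumes x: "x < N" and AB: "A \<in> K" "B \<in> K" "A \<noteq> B"
  shows "even (card {V. V \<subseteq> {..<N} - {x, y} \<and>
    (bij_betw f V (K - {A}) \<and> nearly_balanced f N K x y V B \<or>
     bij_betw f V (K - {B}) \<and> nearly_balanced f N K x y V A)})"
proof -
  define Vs where "Vs = Pow ({..<N} - {x, y})"
  define W where "W V = {v \<in> V. bij_betw f (V - {v}) (K - {A, B}) \<and> f v \<in> K \<and>
      nearly_balanced f N K x y V (f v)}" for V
  define Us where "Us = {U \<in> Vs. bij_betw f U (K - {A, B})}"
  define C where "C U = {v. v < N \<and> v \<notin> U \<union> {x, y} \<and> f v \<in> K \<and>
      nearly_balanced f N K x y (insert v U) (f v)}" for U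
  have fin: "finite Vs" "finite Us" "\<And>V. V \<in> Vs \<Longrightarrow> finite V" "\<And>U. finite (C U)"
    by (auto simp: Vs_def Us_def C_def intro: finite_subset)
  have finW: "finite (W V)" if "V \<in> Vs" for V
    using fin(3) [OF that] by (simp add: W_def)
  \<comment> \<open>Removing \<open>v\<close> from \<open>V\<close> and putting it back translate
    between the two ways of listing the pairs.\<close>
  have "bij_betw (\<lambda>(V, v). (V - {v}, v)) (Sigma Vs W) (Sigma Us C)"
    by (rule bij_betw_byWitness [where f' = "\<lambda>(U, v). (insert v U, v)"])
      (auto simp: Vs_def Us_def W_def C_def insert_absorb)
  then have "card (Sigma Vs W) = card (Sigma Us C)"
    by (rule bij_betw_same_card)
  then have "(\<Sum>V\<in>Vs. card (W V)) = (\<Sum>U\<in>Us. card (C U))"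
    using fin finW by simp
  moreover have "even (\<Sum>U\<in>Us. card (C U))"
    using even_card_nearly_balanced [OF _ x] unfolding C_def
    by (intro dvd_sum) (auto simp: Us_def Vs_def)
  ultimately have "even (\<Sum>V\<in>Vs. card (W V))"
    by simp
  then have "even (card {V \<in> Vs. odd (card (W V))})"
    unfolding even_sum_iff [OF fin(1)] .
  moreover have "odd (card (W V)) \<longleftrightarrow>
      bij_betw f V (K - {A}) \<and> nearly_balanced f N K x y V B \<or>
      bij_betw f V (K - {B}) \<and> nearly_balanced f N K x y V A" if "V \<in> Vs" for V
    unfolding W_def by (rule odd_card_removable [OF fin(3) [OF that] AB])
  ultimately show ?thesis
    by (simp add: Vs_def cong: conj_cong)
qed

text \<open>The transposition alters only the relative order of \<open>x\<close> and
  \<open>Suc x\<close>. So the number of cuts in front of an uncut bead changes, by one, only if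
  that bead is one of the two and the other one is cut.\<close>

lemma alt_sign_transpose:
  assumes "finite T" and "j \<notin> T"
  shows "alt_sign (transpose x (Suc x) ` T) (transpose x (Suc x) j) =
    (if j = Suc x \<and> x \<in> T \<or> j = x \<and> Suc x \<in> T then - alt_sign T j else alt_sign T j)"
proof -
  let ?t = "transpose x (Suc x)"
  have "{t \<in> ?t ` T. t < ?t j} = ?t ` {t \<in> T. ?t t < ?t j}"
    by auto
  then have *: "card {t \<in> ?t ` T. t < ?t j} = card {t \<in> T. ?t t < ?t j}"
    by (simp add: card_image)
  show ?thesis
  proof (cases "j = Suc x \<and> x \<in> T \<or> j = x \<and> Suc x \<in> T")
    case True
    then consider "j = Suc x" "x \<in> T" | "j = x" "Suc x \<in> T"
      by auto
    then show ?thesis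
    proof cases
      case 1
      then have "{t \<in> T. t < j} = insert x {t \<in> T. ?t t < ?t j}"
        using assms by (auto simp: transpose_def split: if_splits)
      moreover have "x \<notin> {t \<in> T. ?t t < ?t j}"
        using 1 by simp
      ultimately show ?thesis
        using 1 assms * by (simp add: alt_sign_def)
    next
      case 2
      then have "{t \<in> T. ?t t < ?t j} = insert (Suc x) {t \<in> T. t < j}"
        using assms by (auto simp: transpose_def split: if_splits)
      then show ?thesis
        using 2 assms * by (simp add: alt_sign_def)
    qed
  next
    case False
    have "?t t < ?t j \<longleftrightarrow> t < j" if "t \<in> T" for t
      using False that assms by (auto simp: transpose_def)
    then have "{t \<in> T. ?t t < ?t j} = {t \<in> T. t < j}"
      by auto
    then show ?thesis
      using False * by (simp add: alt_sign_def)
  qed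
qed

lemma imbalance_transpose:
  assumes "Suc x < N"
  shows "imbalance (f \<circ> transpose x (Suc x)) N (transpose x (Suc x) ` T) s c =
    imbalance f N T (s \<circ> transpose x (Suc x)) c"
proof -
  let ?t = "transpose x (Suc x)"
  have N: "?t j < N \<longleftrightarrow> j < N" for j
    using assms by (auto simp: transpose_def)
  have T: "?t j \<in> T \<longleftrightarrow> j \<in> ?t ` T" for j
    using imageI [of "?t j" T ?t] by auto
  have "bij_betw ?t {j. j < N \<and> f j = c \<and> j \<notin> T} {j. j < N \<and> (f \<circ> ?t) j = c \<and> j \<notin> ?t ` T}"
  proof (rule bij_betw_byWitness [where f' = ?t])
    show "?t ` {j. j < N \<and> f j = c \<and> j \<notin> T} \<subseteq> {j. j < N \<and> (f \<circ> ?t) j = c \<and> j \<notin> ?t ` T}"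
      unfolding T [symmetric] by (auto simp: N)
    show "?t ` {j. j < N \<and> (f \<circ> ?t) j = c \<and> j \<notin> ?t ` T} \<subseteq> {j. j < N \<and> f j = c \<and> j \<notin> T}"
      unfolding T [symmetric] by (auto simp: N)
  qed auto
  from sum.reindex_bij_betw [OF this, of s] show ?thesis
    by (simp add: imbalance_def)
qed

lemma collect_eq_image:
  assumes "\<And>T. P (g T) \<longleftrightarrow> T \<in> X" and "\<And>T. g (g T) = T"
  shows "{T. P T} = g ` X"
proof (intro set_eqI iffI)
  fix T
  assume "T \<in> {T. P T}"
  then have "g T \<in> X"
    using assms(1) [of "g T"] by (simp add: assms(2))
  then have "g (g T) \<in> g ` X"
    by (rule imageI)
  then show "T \<in> g ` X"
    by (simp only: assms(2))
qed (use assms(1) in auto)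

text \<open>Pulled back along the transposition, the halvings of the swapped necklace become
  \<open>X'\<close>: transversals of the original necklace that are balanced for the signs
  \<open>s'\<close>. It suffices that the symmetric difference of \<open>X\<close> and
  \<open>X'\<close> is even. Its members cut exactly one of the two swapped beads, and deleting that
  bead turns them into the sets counted in \<open>even_card_swap_defects\<close>.\<close>

lemma even_card_halving_swap:
  fixes f :: "nat \<Rightarrow> 'k"
  assumes x: "Suc x < N" and K: "f x \<in> K" "f (Suc x) \<in> K" and ne: "f x \<noteq> f (Suc x)"
  shows "even (card {T. halving (f \<circ> transpose x (Suc x)) N K T}) \<longleftrightarrow>
    even (card {T. halving f N K T})"
proof -
  let ?t = "transpose x (Suc x)"
  define y where "y = Suc x"
  have xy: "x < N" "y < N" "x \<noteq> y" "f x \<noteq> f y"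
    using x ne by (auto simp: y_def)
  define bal where "bal s T \<longleftrightarrow> (\<forall>c\<in>K. imbalance f N T s c = 0)" for s T
  define s' where "s' T j =
    (if j = y \<and> x \<in> T \<or> j = x \<and> y \<in> T then - alt_sign T j else alt_sign T j)" for T j
  define X where "X = {T. T \<subseteq> {..<N} \<and> bij_betw f T K \<and> bal (alt_sign T) T}"
  define X' where "X' = {T. T \<subseteq> {..<N} \<and> bij_betw f T K \<and> bal (s' T) T}"
  have fin: "finite X" "finite X'"
    by (rule finite_subset [of _ "Pow {..<N}"]; auto simp: X_def X'_def)+
  have "halving (f \<circ> ?t) N K (?t ` T) \<longleftrightarrow> T \<in> X'" for T
  proof (cases "T \<subseteq> {..<N}")
    case True
    then have "finite T"
      by (auto intro: finite_subset)
    then have "imbalance f N T (alt_sign (?t ` T) \<circ> ?t) c = imbalance f N T (s' T) c" for c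
      by (intro imbalance_cong) (simp add: alt_sign_transpose s'_def y_def)
    moreover have "?t ` T \<subseteq> {..<N}"
      using True x by (auto simp: transpose_def)
    moreover have "bij_betw (f \<circ> ?t) (?t ` T) K \<longleftrightarrow> bij_betw f T K"
      using bij_betw_comp_iff [of ?t T "?t ` T" "f \<circ> ?t" K]
      by (simp add: comp_assoc bij_betw_def)
    ultimately show ?thesis
      using True x by (simp add: halving_def X'_def bal_def imbalance_transpose)
  next
    case False
    then obtain t where "t \<in> T" "\<not> t < N"
      by auto
    then have "\<not> ?t ` T \<subseteq> {..<N}"
      using x by (auto simp: transpose_def image_subset_iff split: if_splits)
    then show ?thesis
      using False by (simp add: halving_def X'_def)
  qed
  moreover have "?t ` ?t ` T = T" for T
    by (simp add: image_image)
  ultimately have "{T. halving (f \<circ> ?t) N K T} = (`) ?t ` X'"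
    by (rule collect_eq_image)
  moreover have "inj_on ((`) ?t) X'"
    by (rule inj_onI) (simp add: inj_image_eq_iff)
  ultimately have X': "card {T. halving (f \<circ> ?t) N K T} = card X'"
    by (simp add: card_image)
  have X: "{T. halving f N K T} = X"
    by (auto simp: halving_def X_def bal_def)
  define D where "D p q = {T. T \<subseteq> {..<N} \<and> bij_betw f T K \<and> p \<in> T \<and> q \<notin> T \<and>
      nearly_balanced f N K x y (T - {p}) (f q)}" for p q
  define E where "E p q = {V. V \<subseteq> {..<N} - {x, y} \<and> bij_betw f V (K - {f p}) \<and>
      nearly_balanced f N K x y V (f q)}" for p q
  have DE: "card (D p q) = card (E p q)" if pq: "{p, q} = {x, y}" for p q
  proof -
    have fp: "f p \<in> K" "p < N"
      using pq K xy by (auto simp: y_def doubleton_eq_iff)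
    have ins: "bij_betw f (insert p V) K \<longleftrightarrow> bij_betw f V (K - {f p})" if "p \<notin> V" for V
      using notIn_Un_bij_betw3 [of p V f "K - {f p}"] that fp by (simp add: insert_absorb)
    have E: "p \<notin> V" "q \<notin> V" if "V \<in> E p q" for V
      using pq that by (auto simp: E_def)
    have pq': "p \<noteq> q" "{x, y} = {p, q}"
      using pq xy by auto
    have "bij_betw (\<lambda>T. T - {p}) (D p q) (E p q)"
    proof (rule bij_betw_byWitness [where f' = "insert p"])
      show "(\<lambda>T. T - {p}) ` D p q \<subseteq> E p q"
      proof (rule image_subsetI)
        fix T
        assume T: "T \<in> D p q"
        then have "bij_betw f (T - {p}) (K - {f p})"
          using ins [of "T - {p}"] by (simp add: D_def insert_absorb)
        then show "T - {p} \<in> E p q"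
          using T unfolding D_def E_def pq' by auto
      qed
      show "insert p ` E p q \<subseteq> D p q"
      proof (rule image_subsetI)
        fix V
        assume V: "V \<in> E p q"
        then show "insert p V \<in> D p q"
          using ins [of V] E [of V] fp pq' by (auto simp: D_def E_def)
      qed
      show "\<forall>T\<in>D p q. insert p (T - {p}) = T"
        by (auto simp: D_def)
      show "\<forall>V\<in>E p q. insert p V - {p} = V"
        using E by auto
    qed
    then show ?thesis
      by (rule bij_betw_same_card)
  qed
  \<comment> \<open>Let \<open>p\<close> be the cut bead and \<open>q\<close> its uncut neighbour.
    The signs \<open>s'\<close> reverse \<open>q\<close> alone among the counted beads, so the two
    conditions are those of \<open>all_zero_toggle\<close>.\<close>
  have key: "bal (alt_sign T) T \<noteq> bal (s' T) T \<longleftrightarrow> nearly_balanced f N K x y (T - {p}) (f q)"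
    if pq: "{p, q} = {x, y}" and T: "T \<subseteq> {..<N}" "p \<in> T" "q \<notin> T" for p q T
  proof -
    let ?R = "imbalance f N (insert q T) (alt_sign T)"
    have q: "q < N" "f q \<in> K"
      using pq xy K by (auto simp: y_def doubleton_eq_iff)
    have plus: "imbalance f N T (alt_sign T) c = ?R c + (if c = f q then alt_sign T q else 0)" for c
      using T q by (simp add: imbalance_split)
    have "imbalance f N (insert q T) (s' T) c = ?R c" for c
      by (rule imbalance_cong) (use pq T in \<open>auto simp: s'_def doubleton_eq_iff\<close>)
    then have minus: "imbalance f N T (s' T) c = ?R c - (if c = f q then alt_sign T q else 0)" for c
      using T q pq by (auto simp: imbalance_split [of q] s'_def doubleton_eq_iff)
    have "bal (alt_sign T) T \<noteq> bal (s' T) T \<longleftrightarrow>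
        (\<forall>c\<in>K. \<bar>?R c\<bar> = (if c = f q then 1 else 0))"
      unfolding bal_def plus minus
      using all_zero_toggle [OF alt_sign_cases [of T q] q(2), of ?R] by blast
    moreover have "insert q T = (T - {p}) \<union> {x, y}"
      using pq T by auto
    \<comment> \<open>In the case \<open>p = y\<close> the cut is at \<open>y\<close>, whereas
      \<open>nearly_balanced\<close> places it at \<open>x\<close>. Only the beads \<open>x\<close>
      and \<open>y\<close> could notice this, and neither of them is counted.\<close>
    moreover have "alt_sign (insert x (T - {p})) j = alt_sign T j" if "j \<notin> insert q T" for j
    proof (cases "p = x")
      case False
      then have eq: "p = y" "q = x"
        using pq by (auto simp: doubleton_eq_iff)
      have "finite T"
        using T by (auto intro: finite_subset)
      moreover have "j \<noteq> y" "x \<notin> T - {y}"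
        using that T eq by auto
      then have "y < j \<longleftrightarrow> x < j"
        by (auto simp: y_def)
      ultimately have "alt_sign (insert y (T - {y})) j = alt_sign (insert x (T - {y})) j"
        using T eq by (simp add: alt_sign_insert del: insert_Diff_single)
      then show ?thesis
        using T by (simp add: eq insert_absorb)
    qed (use T in \<open>simp add: insert_absorb\<close>)
    then have "imbalance f N (insert q T) (alt_sign (insert x (T - {p}))) c = ?R c" for c
      by (intro imbalance_cong) auto
    ultimately show ?thesis
      by (simp add: nearly_balanced_def)
  qed
  have none: "bal (alt_sign T) T = bal (s' T) T" if "x \<in> T \<longleftrightarrow> y \<in> T" for T
  proof -
    have "imbalance f N T (alt_sign T) c = imbalance f N T (s' T) c" for c
      by (rule imbalance_cong) (use that in \<open>auto simp: s'_def\<close>)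
    then show ?thesis
      by (simp add: bal_def)
  qed
  have "(X - X') \<union> (X' - X) = D x y \<union> D y x"
    unfolding X_def X'_def D_def using key [of x y] key [of y x] none by blast
  then have "card ((X - X') \<union> (X' - X)) = card (D x y) + card (D y x)"
    by (simp only:) (rule card_Un_disjoint; auto simp: D_def intro: finite_subset [of _ "Pow {..<N}"])
  also have "\<dots> = card (E x y) + card (E y x)"
    by (simp add: DE insert_commute)
  also have "\<dots> = card (E x y \<union> E y x)"
  proof (rule card_Un_disjoint [symmetric])
    show "finite (E x y)" "finite (E y x)"
      by (rule finite_subset [of _ "Pow {..<N}"]; auto simp: E_def)+
    \<comment> \<open>The kinds occurring in such a \<open>V\<close> are \<open>K\<close> without
      \<open>f x\<close> and \<open>K\<close> without \<open>f y\<close>, respectively.\<close>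
    show "E x y \<inter> E y x = {}"
      using xy K by (auto simp: E_def bij_betw_def y_def)
  qed
  also have "E x y \<union> E y x = {V. V \<subseteq> {..<N} - {x, y} \<and>
    (bij_betw f V (K - {f x}) \<and> nearly_balanced f N K x y V (f y) \<or>
     bij_betw f V (K - {f y}) \<and> nearly_balanced f N K x y V (f x))}"
    by (auto simp: E_def)
  finally have "even (card ((X - X') \<union> (X' - X)))"
    using even_card_swap_defects [of x N "f x" K "f y" y f] xy K by (simp add: y_def)
  then have "even (card (X - X') + card (X' - X))"
    using fin by (subst (asm) card_Un_disjoint) auto
  moreover have "card X = card (X \<inter> X') + card (X - X')" "card X' = card (X \<inter> X') + card (X' - X)"
    using card_Int_Diff [of X X'] card_Int_Diff [of X' X] fin by (simp_all add: Int_commute)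
  ultimately show ?thesis
    unfolding X' X by auto
qed

subsection \<open>Existence of halvings\<close>

lemma odd_card_halving_swap_list:
  assumes "a \<in> K" and "b \<in> K"
  shows "odd (card {T. halving ((!) (us @ b # a # vs)) (length (us @ b # a # vs)) K T}) \<longleftrightarrow>
    odd (card {T. halving ((!) (us @ a # b # vs)) (length (us @ a # b # vs)) K T})"
proof (cases "a = b")
  case False
  let ?x = "length us"
  have "(!) (us @ b # a # vs) = (!) (us @ a # b # vs) \<circ> transpose ?x (Suc ?x)"
    by (rule ext) (auto simp: nth_append nth_Cons transpose_def split: nat.split)
  moreover have "(us @ a # b # vs) ! ?x = a" "(us @ a # b # vs) ! Suc ?x = b"
    by (auto simp: nth_append)
  ultimately show ?thesis
    using even_card_halving_swap [of ?x "length (us @ a # b # vs)" "(!) (us @ a # b # vs)" K] assms False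
    by simp
qed simp

lemma odd_card_halving_move:
  assumes "a \<in> K" and "set vs \<subseteq> K"
  shows "odd (card {T. halving ((!) (us @ a # vs @ ws)) (length (us @ a # vs @ ws)) K T}) \<longleftrightarrow>
    odd (card {T. halving ((!) (us @ vs @ a # ws)) (length (us @ vs @ a # ws)) K T})"
  using assms(2)
proof (induction vs arbitrary: us)
  case (Cons v vs)
  then show ?case
    using odd_card_halving_swap_list [of v K a us "vs @ ws"] Cons.IH [of "us @ [v]"] assms(1) by simp
qed simp

text \<open>As in insertion sort: the tail is arranged first, and then the first bead moves behind
  the block of beads \<open>c\<close>; if it is itself of kind \<open>c\<close>, this changes
  nothing. In the induction \<open>us\<close> collects the beads already passed.\<close>

lemma odd_card_halving_partition:
  assumes "set xs \<subseteq> K" and "c \<in> K"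
  defines "ys \<equiv> replicate (count_list xs c) c @ filter (\<lambda>x. x \<noteq> c) xs"
  shows "odd (card {T. halving ((!) xs) (length xs) K T}) \<longleftrightarrow>
    odd (card {T. halving ((!) ys) (length ys) K T})"
proof -
  define P where "P zs \<longleftrightarrow> odd (card {T. halving ((!) zs) (length zs) K T})" for zs
  have "P (us @ xs) \<longleftrightarrow> P (us @ replicate (count_list xs c) c @ filter (\<lambda>x. x \<noteq> c) xs)" for us
    using assms(1)
  proof (induction xs arbitrary: us)
    case (Cons x xs)
    let ?r = "replicate (count_list xs c) c"
    have "P (us @ x # xs) \<longleftrightarrow> P (us @ x # ?r @ filter (\<lambda>x. x \<noteq> c) xs)"
      using Cons.IH [of "us @ [x]"] Cons.prems by simp
    moreover have "P (us @ x # ?r @ filter (\<lambda>x. x \<noteq> c) xs) \<longleftrightarrow> P (us @ ?r @ x # filter (\<lambda>x. x \<noteq> c) xs)"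
      unfolding P_def using Cons.prems assms(2) by (intro odd_card_halving_move) auto
    ultimately show ?case
      by (cases "x = c") simp_all
  qed simp
  from this [of "[]"] show ?thesis
    by (simp add: P_def ys_def)
qed

section \<open>Stripping a leading block of one kind\<close>

lemma sum_sign_step:
  assumes "t < m"
  shows "(\<Sum>j\<in>{..<m} - {t}. if j < t then 1 else - 1 :: int) = int t - int (m - Suc t)"
proof -
  have "{..<m} - {t} = {..<t} \<union> {Suc t..<m}"
    using assms by auto
  moreover have "(\<Sum>j\<in>{..<t} \<union> {Suc t..<m}. if j < t then 1 else - 1 :: int) =
      (\<Sum>j\<in>{..<t}. if j < t then 1 else - 1) + (\<Sum>j\<in>{Suc t..<m}. if j < t then 1 else - 1)"
    by (rule sum.union_disjoint) auto
  ultimately have "(\<Sum>j\<in>{..<m} - {t}. if j < t then 1 else - 1 :: int) =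
      (\<Sum>j\<in>{..<t}. if j < t then 1 else - 1) + (\<Sum>j\<in>{Suc t..<m}. if j < t then 1 else - 1)"
    by (simp only:)
  also have "\<dots> = (\<Sum>j\<in>{..<t}. 1) + (\<Sum>j\<in>{Suc t..<m}. - 1)"
    by (intro arg_cong2 [of _ _ _ _ "(+)"] sum.cong) auto
  finally show ?thesis
    by simp
qed

text \<open>All beads of kind \<open>c\<close> lie in the leading block, whose only cut is
  \<open>t\<close>; they balance iff \<open>t\<close> is the middle bead. The beads of
  \<open>ys\<close> have one more cut in front of them, which reverses all their signs and so
  preserves their balance.\<close>

lemma halving_replicate_append:
  assumes c: "c \<notin> K" and ys: "set ys \<subseteq> K" and t: "t < m" and T: "T \<subseteq> {..<length ys}"
  defines "xs \<equiv> replicate m c @ ys"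
  shows "halving ((!) xs) (length xs) (insert c K) (insert t ((+) m ` T)) \<longleftrightarrow>
    2 * t + 1 = m \<and> halving ((!) ys) (length ys) K T"
proof -
  define T' where "T' = insert t ((+) m ` T)"
  have finT: "finite T"
    using T by (auto intro: finite_subset)
  have len: "length xs = m + length ys"
    by (simp add: xs_def)
  have nth: "xs ! j = (if j < m then c else ys ! (j - m))" for j
    by (simp add: xs_def nth_append)
  have ysK: "ys ! j \<in> K" if "j < length ys" for j
    using ys that by (auto simp: subset_iff)
  have bij: "bij_betw ((!) xs) T' (insert c K) \<longleftrightarrow> bij_betw ((!) ys) T K"
  proof -
    have "bij_betw ((!) xs) T' (insert c K) \<longleftrightarrow> bij_betw ((!) xs) ((+) m ` T) K"
      using notIn_Un_bij_betw3 [of t "(+) m ` T" "(!) xs" K] t c by (auto simp: T'_def nth)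
    also have "\<dots> \<longleftrightarrow> bij_betw ((!) xs \<circ> (+) m) T K"
      by (rule bij_betw_comp_iff) (simp add: bij_betw_def)
    also have "(!) xs \<circ> (+) m = (!) ys"
      by (rule ext) (simp add: nth)
    finally show ?thesis .
  qed
  have sign_less: "alt_sign T' j = (if j < t then 1 else - 1)" if "j < m" "j \<noteq> t" for j
  proof -
    have "{u \<in> T'. u < j} = (if j < t then {} else {t})"
      using that by (auto simp: T'_def)
    then show ?thesis
      by (simp add: alt_sign_def)
  qed
  have "{u \<in> T'. u < m + j} = insert t ((+) m ` {u \<in> T. u < j})" for j
    using t by (auto simp: T'_def)
  then have sign_add: "alt_sign T' (m + j) = - alt_sign T j" for j
    using t finT by (simp add: alt_sign_def card_image image_iff)
  have "{j. j < length xs \<and> xs ! j = c \<and> j \<notin> T'} = {..<m} - {t}"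
  proof (intro set_eqI iffI)
    fix j
    assume j: "j \<in> {j. j < length xs \<and> xs ! j = c \<and> j \<notin> T'}"
    have "j < m"
    proof (rule ccontr)
      assume "\<not> j < m"
      then have "ys ! (j - m) = c" "j - m < length ys"
        using j by (auto simp: nth len)
      then show False
        using ysK c by blast
    qed
    then show "j \<in> {..<m} - {t}"
      using j by (auto simp: T'_def)
  next
    fix j
    assume "j \<in> {..<m} - {t}"
    then show "j \<in> {j. j < length xs \<and> xs ! j = c \<and> j \<notin> T'}"
      by (auto simp: nth T'_def len)
  qed
  then have "imbalance ((!) xs) (length xs) T' (alt_sign T') c =
      (\<Sum>j\<in>{..<m} - {t}. if j < t then 1 else - 1)"
    unfolding imbalance_def by (intro sum.cong) (auto simp: sign_less)
  then have c0: "imbalance ((!) xs) (length xs) T' (alt_sign T') c = 0 \<longleftrightarrow> 2 * t + 1 = m"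
    using t by (auto simp: sum_sign_step)
  have K0: "imbalance ((!) xs) (length xs) T' (alt_sign T') k =
      - imbalance ((!) ys) (length ys) T (alt_sign T) k" if "k \<in> K" for k
  proof -
    have "{j. j < length xs \<and> xs ! j = k \<and> j \<notin> T'} = (+) m ` {j. j < length ys \<and> ys ! j = k \<and> j \<notin> T}"
      (is "?L = _ ` ?R")
    proof (intro set_eqI iffI)
      fix j
      assume j: "j \<in> ?L"
      then have "j \<ge> m"
        using that c by (auto simp: nth split: if_splits)
      then have "j - m \<in> ?R" "j = m + (j - m)"
        using j by (auto simp: nth T'_def len image_iff)
      then show "j \<in> (+) m ` ?R"
        by blast
    next
      fix j
      assume "j \<in> (+) m ` ?R"
      then show "j \<in> ?L"
        using t by (auto simp: nth T'_def len)
    qed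
    then show ?thesis
      by (simp add: imbalance_def sum.reindex sign_add sum_negf)
  qed
  have "T' \<subseteq> {..<length xs}"
    using t T by (auto simp: T'_def len)
  then show ?thesis
    using T bij c0 K0 by (auto simp: halving_def T'_def [symmetric])
qed

text \<open>A halving cuts exactly one bead of kind \<open>c\<close>, so it has the shape treated in
  \<open>halving_replicate_append\<close>; as \<open>m\<close> is odd, the middle bead exists and
  there is just one choice for \<open>t\<close>.\<close>

lemma odd_card_halving_replicate:
  assumes c: "c \<notin> K" and ys: "set ys \<subseteq> K" and m: "odd m"
  defines "xs \<equiv> replicate m c @ ys"
  shows "card {T. halving ((!) xs) (length xs) (insert c K) T} =
    card {T. halving ((!) ys) (length ys) K T}"
proof -
  obtain t where t: "m = 2 * t + 1"
    using m by (elim oddE)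
  define g where "g T = insert t ((+) m ` T)" for T
  have "inj g"
  proof (rule inj_on_inverseI)
    show "{j. m + j \<in> g T} = T" for T
      using t by (auto simp: g_def)
  qed
  moreover have "{T. halving ((!) xs) (length xs) (insert c K) T} =
      g ` {T. halving ((!) ys) (length ys) K T}"
  proof (intro set_eqI iffI)
    fix T
    assume "T \<in> {T. halving ((!) xs) (length xs) (insert c K) T}"
    then have T: "halving ((!) xs) (length xs) (insert c K) T"
      by simp
    then have sub: "T \<subseteq> {..<m + length ys}" and inj: "inj_on ((!) xs) T" and img: "(!) xs ` T = insert c K"
      by (auto simp: halving_def xs_def bij_betw_def)
    define T' where "T' = {j. m + j \<in> T}"
    obtain u where u: "u \<in> T" "xs ! u = c"
      using img by (metis imageE insertI1)
    have "u < m"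
    proof (rule ccontr)
      assume "\<not> u < m"
      then have "xs ! u = ys ! (u - m)" "u - m < length ys"
        using u sub by (auto simp: xs_def nth_append)
      then have "xs ! u \<in> K"
        using ys by auto
      then show False
        using u c by simp
    qed
    have one: "v = u" if "v \<in> T" "v < m" for v
    proof (rule inj_onD [OF inj])
      show "xs ! v = xs ! u"
        using that u by (simp add: xs_def nth_append)
    qed (use that u in auto)
    have "T = insert u ((+) m ` T')"
    proof (intro set_eqI iffI)
      fix v
      assume v: "v \<in> T"
      show "v \<in> insert u ((+) m ` T')"
      proof (cases "v < m")
        case False
        then have "v - m \<in> T'" "v = m + (v - m)"
          using v by (simp_all add: T'_def)
        then show ?thesis
          by blast
      qed (use v one in simp)
    qed (use u in \<open>auto simp: T'_def\<close>)
    moreover have "T' \<subseteq> {..<length ys}"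
      using sub by (auto simp: T'_def)
    ultimately have "2 * u + 1 = m \<and> halving ((!) ys) (length ys) K T'"
      using T halving_replicate_append [OF c ys \<open>u < m\<close>, of T'] by (simp add: xs_def)
    then show "T \<in> g ` {T. halving ((!) ys) (length ys) K T}"
      using \<open>T = insert u ((+) m ` T')\<close> t by (auto simp: g_def)
  next
    fix T
    assume "T \<in> g ` {T. halving ((!) ys) (length ys) K T}"
    then obtain S where "T = g S" "halving ((!) ys) (length ys) K S"
      by auto
    then show "T \<in> {T. halving ((!) xs) (length xs) (insert c K) T}"
      using halving_replicate_append [OF c ys, of t m S] t by (simp add: g_def xs_def halving_def)
  qed
  ultimately show ?thesis
    by (simp add: card_image inj_on_subset)
qed

text \<open>The kinds are removed one by one: gathering the beads of kind \<open>c\<close> preserves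
  the parity, and stripping their block preserves the number. For the empty necklace only the empty
  set remains.\<close>

theorem odd_card_halving:
  assumes "finite K" and "set xs \<subseteq> K" and "\<And>c. c \<in> K \<Longrightarrow> odd (count_list xs c)"
  shows "odd (card {T. halving ((!) xs) (length xs) K T})"
  using assms
proof (induction K arbitrary: xs rule: finite_induct)
  case empty
  then have "{T. halving ((!) xs) (length xs) {} T} = {{}}"
    by (auto simp: halving_def bij_betw_def)
  then show ?case
    by simp
next
  case (insert c K)
  let ?ys = "filter (\<lambda>x. x \<noteq> c) xs"
  have "odd (card {T. halving ((!) ?ys) (length ?ys) K T})"
  proof (rule insert.IH)
    show "set ?ys \<subseteq> K"
      using insert.prems by auto
    fix k
    assume k: "k \<in> K"
    then have "count_list ?ys k = count_list xs k"
      using insert.hyps by (induction xs) auto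
    then show "odd (count_list ?ys k)"
      using insert.prems k by simp
  qed
  moreover have "set ?ys \<subseteq> K"
    using insert.prems by auto
  ultimately show ?case
    using odd_card_halving_partition [of xs "insert c K" c]
      odd_card_halving_replicate [of c K ?ys "count_list xs c"] insert
    by simp
qed

section \<open>From halvings to two-colourings with few changes\<close>

lemma count_list_conv_card: "count_list xs c = card {j. j < length xs \<and> xs ! j = c}"
proof -
  have "count_list xs c = length (filter (\<lambda>x. x = c) xs)"
    by (induction xs) auto
  then show ?thesis
    by (simp add: length_filter_conv_card)
qed

lemma balanced_card:
  assumes "imbalance f N Z (alt_sign T) c = 0" and "card {j. j < N \<and> f j = c \<and> j \<notin> Z} = 2 * m"
  shows "card {j. j < N \<and> f j = c \<and> j \<notin> Z \<and> odd (card {t \<in> T. t < j})} = m"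
proof -
  let ?P = "{j. j < N \<and> f j = c \<and> j \<notin> Z}" and ?odd = "\<lambda>j. odd (card {t \<in> T. t < j})"
  have P: "{j \<in> ?P. ?odd j} \<union> {j \<in> ?P. \<not> ?odd j} = ?P"
    by auto
  have disj: "{j \<in> ?P. ?odd j} \<inter> {j \<in> ?P. \<not> ?odd j} = {}"
    by auto
  have "imbalance f N Z (alt_sign T) c = (\<Sum>j\<in>{j \<in> ?P. ?odd j} \<union> {j \<in> ?P. \<not> ?odd j}. alt_sign T j)"
    unfolding P imbalance_def ..
  also have "\<dots> = (\<Sum>j\<in>{j \<in> ?P. ?odd j}. alt_sign T j) + (\<Sum>j\<in>{j \<in> ?P. \<not> ?odd j}. alt_sign T j)"
    using disj by (intro sum.union_disjoint) auto
  also have "(\<Sum>j\<in>{j \<in> ?P. ?odd j}. alt_sign T j) = (\<Sum>j\<in>{j \<in> ?P. ?odd j}. - 1)"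
    by (rule sum.cong) (auto simp: alt_sign_def)
  also have "(\<Sum>j\<in>{j \<in> ?P. \<not> ?odd j}. alt_sign T j) = (\<Sum>j\<in>{j \<in> ?P. \<not> ?odd j}. 1)"
    by (rule sum.cong) (auto simp: alt_sign_def)
  finally have "card {j \<in> ?P. ?odd j} = card {j \<in> ?P. \<not> ?odd j}"
    using assms(1) by simp
  moreover have "card ?P = card {j \<in> ?P. ?odd j} + card {j \<in> ?P. \<not> ?odd j}"
    using card_Un_disjoint [OF _ _ disj] unfolding P by simp
  ultimately have "card {j \<in> ?P. ?odd j} = m"
    using assms(2) by simp
  then show ?thesis
    by (simp add: conj_assoc)
qed

text \<open>Here \<open>g t\<close> is the gap to which the cut through bead \<open>t\<close> is
  moved, so \<open>g t \<le> j\<close> says that it lies in front of bead \<open>j\<close>. A change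
  between \<open>j\<close> and \<open>Suc j\<close> needs a cut at the gap \<open>Suc j\<close>;
  this bounds the changes by the number of cuts.\<close>

lemma parity_changes_subset:
  fixes g :: "'a \<Rightarrow> nat"
  shows "{j. odd (card {t \<in> T. g t \<le> j}) \<noteq> odd (card {t \<in> T. g t \<le> Suc j})} \<subseteq> (\<lambda>t. g t - 1) ` T"
proof
  fix j
  assume "j \<in> {j. odd (card {t \<in> T. g t \<le> j}) \<noteq> odd (card {t \<in> T. g t \<le> Suc j})}"
  then have "{t \<in> T. g t \<le> j} \<noteq> {t \<in> T. g t \<le> Suc j}"
    by auto
  then obtain t where "t \<in> T" "g t = Suc j"
    by (auto simp: le_Suc_eq)
  then show "j \<in> (\<lambda>t. g t - 1) ` T"
    by force
qed

text \<open>The thief who lacks a bead of kind \<open>c\<close> once the appended bead \<open>e c\<close> is removed receives the cut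
  bead of kind \<open>c\<close>: the cut is moved before or behind that bead.\<close>

lemma two_colouring:
  assumes K: "finite K" and xs: "set xs \<subseteq> K" and count: "\<And>c. c \<in> K \<Longrightarrow> count_list xs c = 2 * a c"
  shows "\<exists>b. (\<forall>c\<in>K. card {j. j < length xs \<and> xs ! j = c \<and> b j} = a c) \<and>
    card {j. Suc j < length xs \<and> b j \<noteq> b (Suc j)} \<le> card K"
proof -
  obtain ks where ks: "set ks = K" "distinct ks"
    using finite_distinct_list [OF K] by auto
  define zs where "zs = xs @ ks"
  define N where "N = length xs"
  have "count_list ks c = 1" if "c \<in> set ks" for c
    using that ks(2) by (induction ks) (auto simp: count_list_0_iff)
  then have "odd (count_list zs c)" if "c \<in> K" for c
    using that count ks by (simp add: zs_def)
  moreover have "set zs \<subseteq> K"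
    using xs ks by (simp add: zs_def)
  ultimately have "odd (card {T. halving ((!) zs) (length zs) K T})"
    using odd_card_halving [OF K] by auto
  then have "{T. halving ((!) zs) (length zs) K T} \<noteq> {}"
    by (metis card.empty even_zero)
  then obtain T where T: "T \<subseteq> {..<length zs}" and bij: "bij_betw ((!) zs) T K"
    and zero: "\<And>c. c \<in> K \<Longrightarrow> imbalance ((!) zs) (length zs) T (alt_sign T) c = 0"
    by (auto simp: halving_def)
  have finT: "finite T"
    using T by (auto intro: finite_subset)
  have "\<exists>j. N \<le> j \<and> j < length zs \<and> zs ! j = c" if "c \<in> K" for c
  proof -
    have "c \<in> set ks"
      using that ks(1) by simp
    then obtain k where "k < length ks" "ks ! k = c"
      unfolding in_set_conv_nth by blast
    then show ?thesis
      by (intro exI [of _ "N + k"]) (simp add: zs_def N_def)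
  qed
  then have "\<forall>c\<in>K. \<exists>j. N \<le> j \<and> j < length zs \<and> zs ! j = c"
    by blast
  from bchoice [OF this] obtain e
    where e: "\<And>c. c \<in> K \<Longrightarrow> N \<le> e c \<and> e c < length zs \<and> zs ! e c = c"
    by blast
  have only_e: "j = e c" if "c \<in> K" "N \<le> j" "j < length zs" "zs ! j = c" for j c
  proof -
    have "ks ! (j - N) = ks ! (e c - N)" "j - N < length ks" "e c - N < length ks"
      using e [OF that(1)] that by (auto simp: zs_def N_def nth_append)
    then have "j - N = e c - N"
      using ks by (simp add: nth_eq_iff_index_eq)
    then show ?thesis
      using e [OF that(1)] that(2) by linarith
  qed
  define p where "p j = odd (card {t \<in> T. t < j})" for j
  \<comment> \<open>\<open>p\<close> is the side of an uncut bead. The cut through \<open>t\<close>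
    moves behind \<open>t\<close> if \<open>t\<close> should stay on its current side, and in front
    of \<open>t\<close> if it should change to the side of the appended bead of its kind.\<close>
  define g where "g t = (if p (e (zs ! t)) = p t then Suc t else t)" for t
  define b where "b j = odd (card {t \<in> T. g t \<le> j})" for j
  have b_out: "b j = p j" if "j \<notin> T" for j
  proof -
    have "{t \<in> T. g t \<le> j} = {t \<in> T. t < j}"
      using that by (auto simp: g_def le_less split: if_splits)
    then show ?thesis
      by (simp add: b_def p_def)
  qed
  have b_in: "b t = p (e (zs ! t))" if "t \<in> T" for t
  proof -
    have "{u \<in> T. g u \<le> t} = (if p (e (zs ! t)) = p t then {u \<in> T. u < t} else insert t {u \<in> T. u < t})"
      using that by (auto simp: g_def le_less split: if_splits)
    then show ?thesis
      using finT by (auto simp: b_def p_def)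
  qed
  have "card {j. j < N \<and> xs ! j = c \<and> b j} = a c" if c: "c \<in> K" for c
  proof -
    define P where "P = {j. j < length zs \<and> zs ! j = c \<and> j \<notin> T}"
    define X where "X = {j. j < N \<and> xs ! j = c}"
    \<comment> \<open>Replacing the cut bead of kind \<open>c\<close> by the appended one matches
      the real beads of kind \<open>c\<close> with the uncut beads of kind \<open>c\<close> in
      \<open>zs\<close>, and sides are preserved. If the appended bead is the cut one, nothing is
      replaced.\<close>
    define \<phi> where "\<phi> j = (if j \<in> T then e c else j)" for j
    have uniq: "s = t" if "s \<in> T" "t \<in> T" "zs ! s = c" "zs ! t = c" for s t
      using bij that by (metis bij_betw_inv_into_left)
    obtain t where t: "t \<in> T" "zs ! t = c"
      using bij c by (metis bij_betw_imp_surj_on imageE)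
    have tN: "t < length zs"
      using t T by auto
    have X: "X = {j. j < N \<and> zs ! j = c}"
      by (auto simp: X_def zs_def N_def nth_append)
    have Nz: "N \<le> length zs"
      by (simp add: N_def zs_def)
    have "bij_betw \<phi> X P"
    proof (rule bij_betw_byWitness [where f' = "\<lambda>j. if j = e c then t else j"])
      have "j = t" if "j \<in> X" "j \<in> T" for j
        using that t uniq X by auto
      then show "\<forall>j\<in>X. (if \<phi> j = e c then t else \<phi> j) = j"
        using e [OF c] X by (auto simp: \<phi>_def)
      show "\<forall>j\<in>P. \<phi> (if j = e c then t else j) = j"
        using t by (auto simp: \<phi>_def P_def)
      show "\<phi> ` X \<subseteq> P"
      proof (rule image_subsetI)
        fix j
        assume j: "j \<in> X"
        show "\<phi> j \<in> P"
        proof (cases "j \<in> T")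
          case True
          have "e c \<notin> T"
          proof
            assume "e c \<in> T"
            then have "j = e c"
              using uniq [OF True] j X e [OF c] by auto
            then show False
              using j X e [OF c] by auto
          qed
          then show ?thesis
            using True e [OF c] by (simp add: \<phi>_def P_def)
        next
          case False
          then show ?thesis
            using j X Nz by (simp add: \<phi>_def P_def)
        qed
      qed
      show "(\<lambda>j. if j = e c then t else j) ` P \<subseteq> X"
      proof (rule image_subsetI)
        fix j
        assume j: "j \<in> P"
        show "(if j = e c then t else j) \<in> X"
        proof (cases "j = e c")
          case True
          then have "t \<noteq> e c"
            using t j by (auto simp: P_def)
          then have "t < N"
            using only_e [OF c _ tN t(2)] by (meson not_le)
          then show ?thesis
            using True t X by simp
        next
          case False
          then have "j < N"
            using only_e [OF c, of j] j by (auto simp: P_def intro: ccontr)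
          then show ?thesis
            using False j X by (simp add: P_def)
        qed
      qed
    qed
    moreover have "p (\<phi> j) = b j" if "j \<in> X" for j
      using that X b_out b_in by (auto simp: \<phi>_def)
    ultimately have bij': "bij_betw \<phi> {j \<in> X. b j} {j \<in> P. p j}"
      unfolding bij_betw_def by (auto simp: inj_on_def)
    have "card P = card X"
      using \<open>bij_betw \<phi> X P\<close> by (simp add: bij_betw_same_card)
    also have "\<dots> = 2 * a c"
      using count [OF c] by (simp add: count_list_conv_card X_def N_def)
    finally have "card {j \<in> P. p j} = a c"
      using balanced_card [OF zero [OF c]] unfolding P_def p_def by (simp add: conj_assoc)
    then show ?thesis
      using bij_betw_same_card [OF bij'] by (simp add: X_def conj_assoc)
  qed
  moreover have "card {j. Suc j < N \<and> b j \<noteq> b (Suc j)} \<le> card K"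
  proof -
    have "{j. Suc j < N \<and> b j \<noteq> b (Suc j)} \<subseteq> (\<lambda>t. g t - 1) ` T"
      using parity_changes_subset [of T g] by (auto simp: b_def)
    then have "card {j. Suc j < N \<and> b j \<noteq> b (Suc j)} \<le> card T"
      using finT by (rule surj_card_le [rotated])
    also have "\<dots> = card K"
      using bij by (rule bij_betw_same_card)
    finally show ?thesis .
  qed
  ultimately show ?thesis
    unfolding N_def by blast
qed

subsection \<open>Splitting along the cube\<close>

definition hamming :: "'a list \<Rightarrow> 'a list \<Rightarrow> nat" where
  "hamming u v = length (filter (\<lambda>(p, q). p \<noteq> q) (zip u v))"

lemma hamming_Nil [simp]: "hamming [] v = 0" "hamming u [] = 0"
  by (simp_all add: hamming_def)

lemma hamming_Cons [simp]: "hamming (p # u) (q # v) = of_bool (p \<noteq> q) + hamming u v"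
  by (simp add: hamming_def)

lemma hamming_refl [simp]: "hamming u u = 0"
  by (induction u) auto

lemma hamming_eq_0: "length u = length v \<Longrightarrow> hamming u v = 0 \<longleftrightarrow> u = v"
  by (induction u v rule: list_induct2) auto

lemma cube_edge_iff:
  assumes "length u = d" and "length v = d"
  shows "cube_edge d u v \<longleftrightarrow> hamming u v = 1"
proof -
  have "hamming u v = card {k. k < d \<and> u ! k \<noteq> v ! k}"
    using assms unfolding hamming_def length_filter_conv_card
    by (intro arg_cong [of _ _ card]) auto
  then show ?thesis
    using assms by (simp add: cube_edge_def cube_vertices_def)
qed

lemma hamming_step:
  assumes "length u = length v" and "hamming u v \<le> Suc h"
  shows "\<exists>u'. length u' = length u \<and> hamming u u' \<le> 1 \<and> hamming u' v \<le> h"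
  using assms
proof (induction u v rule: list_induct2)
  case (Cons p u q v)
  show ?case
  proof (cases "p = q")
    case True
    then obtain u' where "length u' = length u" "hamming u u' \<le> 1" "hamming u' v \<le> h"
      using Cons by auto
    then show ?thesis
      using True by (intro exI [of _ "q # u'"]) simp
  next
    case False
    then show ?thesis
      using Cons by (intro exI [of _ "q # u"]) simp
  qed
qed simp

text \<open>Each step corrects the first wrong coordinate, or rests if there is none. Resting steps
  allow a walk of any prescribed length \<open>h\<close> from the Hamming distance upwards.\<close>

lemma lazy_walk:
  assumes "length u = d" and "length v = d" and "hamming u v \<le> h"
  shows "\<exists>us. length us = h \<and> last (u # us) = v \<and> set us \<subseteq> {v. length v = d} \<and>
    successively (\<lambda>u v. hamming u v \<le> 1) (u # us)"
  using assms
proof (induction h arbitrary: u)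
  case 0
  then show ?case
    by (simp add: hamming_eq_0)
next
  case (Suc h)
  then obtain u' where u': "length u' = length u" "hamming u u' \<le> 1" "hamming u' v \<le> h"
    using hamming_step [of u v h] by auto
  then obtain us where "length us = h" "last (u' # us) = v" "set us \<subseteq> {v. length v = d}"
    "successively (\<lambda>u v. hamming u v \<le> 1) (u' # us)"
    using Suc.IH [of u'] Suc.prems by auto
  then show ?case
    using u' Suc.prems by (intro exI [of _ "u' # us"]) simp
qed

lemma cube_colouring:
  fixes xs :: "'k list"
  assumes K: "finite K" and xs: "set xs \<subseteq> K" and count: "\<And>c. c \<in> K \<Longrightarrow> count_list xs c = 2 ^ d * a c"
  shows "\<exists>V :: nat \<Rightarrow> bool list. (\<forall>j. length (V j) = d) \<and>
    (\<forall>c\<in>K. \<forall>v. length v = d \<longrightarrow> card {j. j < length xs \<and> xs ! j = c \<and> V j = v} = a c) \<and>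
    (\<Sum>j | Suc j < length xs. hamming (V j) (V (Suc j))) \<le> (2 ^ d - 1) * card K"
  using count
proof (induction d arbitrary: a)
  case 0
  then show ?case
    by (intro exI [of _ "\<lambda>_. []"]) (auto simp: count_list_conv_card)
next
  case (Suc d)
  \<comment> \<open>With one coordinate fewer, each vertex stands for two thieves and receives twice
    as many beads.\<close>
  have "count_list xs c = 2 ^ d * (2 * a c)" if "c \<in> K" for c
    using Suc.prems [OF that] by simp
  from Suc.IH [of "\<lambda>c. 2 * a c", OF this] obtain V :: "nat \<Rightarrow> bool list" where len: "\<And>j. length (V j) = d"
    and V: "\<And>c v. c \<in> K \<Longrightarrow> length v = d \<Longrightarrow>
      card {j. j < length xs \<and> xs ! j = c \<and> V j = v} = 2 * a c"
    and changes: "(\<Sum>j | Suc j < length xs. hamming (V j) (V (Suc j))) \<le> (2 ^ d - 1) * card K"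
    by blast
  \<comment> \<open>The refined kinds are the pairs of an old kind and a vertex of the smaller cube;
    each has \<open>2 * a c\<close> beads, and halving them yields the new coordinate
    \<open>b\<close>.\<close>
  define ys where "ys = map (\<lambda>j. (xs ! j, V j)) [0..<length xs]"
  have ys: "length ys = length xs" "\<And>j. j < length xs \<Longrightarrow> ys ! j = (xs ! j, V j)"
    by (simp_all add: ys_def)
  define K' where "K' = K \<times> {v :: bool list. length v = d}"
  have bools: "finite {v :: bool list. length v = d}" "card {v :: bool list. length v = d} = 2 ^ d"
    using finite_lists_length_eq [of "UNIV :: bool set" d] card_lists_length_eq [of "UNIV :: bool set" d]
    by simp_all
  have "\<exists>b. (\<forall>k\<in>K'. card {j. j < length ys \<and> ys ! j = k \<and> b j} = (a \<circ> fst) k) \<and>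
      card {j. Suc j < length ys \<and> b j \<noteq> b (Suc j)} \<le> card K'"
  proof (rule two_colouring)
    show "finite K'"
      using K bools by (simp add: K'_def)
    show "set ys \<subseteq> K'"
      using xs len by (auto simp: ys_def K'_def subset_iff)
    show "count_list ys k = 2 * (a \<circ> fst) k" if "k \<in> K'" for k
    proof -
      have "{j. j < length ys \<and> ys ! j = k} = {j. j < length xs \<and> xs ! j = fst k \<and> V j = snd k}"
        using ys by (auto simp: prod_eq_iff)
      then show ?thesis
        using that V by (auto simp: count_list_conv_card K'_def)
    qed
  qed
  then obtain b where b: "\<And>k. k \<in> K' \<Longrightarrow> card {j. j < length ys \<and> ys ! j = k \<and> b j} = a (fst k)"
    and b_changes: "card {j. Suc j < length ys \<and> b j \<noteq> b (Suc j)} \<le> card K'"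
    by auto
  have "card {j. j < length xs \<and> xs ! j = c \<and> b j # V j = w} = a c" if c: "c \<in> K" and w: "length w = Suc d" for c w
  proof -
    obtain p v where pv: "w = p # v" "length v = d"
      using w by (auto simp: length_Suc_conv)
    let ?X = "{j. j < length xs \<and> xs ! j = c \<and> V j = v}"
    have "{j \<in> ?X. b j} = {j. j < length ys \<and> ys ! j = (c, v) \<and> b j}"
      using ys by auto
    then have b1: "card {j \<in> ?X. b j} = a c"
      using b [of "(c, v)"] c pv by (simp add: K'_def)
    have "card ?X = card (?X \<inter> {j. b j}) + card (?X - {j. b j})"
      by (rule card_Int_Diff) simp
    moreover have "?X \<inter> {j. b j} = {j \<in> ?X. b j}" "?X - {j. b j} = {j \<in> ?X. \<not> b j}"
      by auto
    ultimately have b0: "card {j \<in> ?X. \<not> b j} = a c"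
      using b1 V [OF c pv(2)] by simp
    have "{j. j < length xs \<and> xs ! j = c \<and> b j # V j = w} = {j \<in> ?X. b j = p}"
      using pv by auto
    then show ?thesis
      using b0 b1 by (cases p) simp_all
  qed
  moreover have "(\<Sum>j | Suc j < length xs. hamming (b j # V j) (b (Suc j) # V (Suc j))) \<le>
      (2 ^ Suc d - 1) * card K"
  proof -
    have fin: "finite {j. Suc j < length xs}"
      by (rule finite_subset [of _ "{..<length xs}"]) auto
    have "(\<Sum>j | Suc j < length xs. of_bool (b j \<noteq> b (Suc j))) = card {j. Suc j < length xs \<and> b j \<noteq> b (Suc j)}"
      using fin by (simp add: of_bool_def sum.If_cases Int_def)
    then have "(\<Sum>j | Suc j < length xs. hamming (b j # V j) (b (Suc j) # V (Suc j))) =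
        card {j. Suc j < length xs \<and> b j \<noteq> b (Suc j)} +
        (\<Sum>j | Suc j < length xs. hamming (V j) (V (Suc j)))"
      by (simp add: sum.distrib)
    \<comment> \<open>There are \<open>card K * 2 ^ d\<close> refined kinds, which bounds the
      changes of \<open>b\<close>; the other summand bounds those of the earlier
      coordinates.\<close>
    also have "\<dots> \<le> card K * 2 ^ d + (2 ^ d - 1) * card K"
      using changes b_changes bools by (intro add_mono) (simp_all add: ys K'_def card_cartesian_product)
    also have "\<dots> = (2 ^ Suc d - 1) * card K"
      by (simp add: algebra_simps diff_mult_distrib)
    finally show ?thesis .
  qed
  ultimately show ?case
    using len by (intro exI [of _ "\<lambda>j. b j # V j"]) auto
qed

section \<open>Cuts, pieces and owners\<close>

lemma count_list_take_drop:
  "count_list (take (m - k) (drop k xs)) i = card {p. k \<le> p \<and> p < m \<and> p < length xs \<and> xs ! p = i}"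
proof -
  let ?ys = "take (m - k) (drop k xs)"
  have "{p. k \<le> p \<and> p < m \<and> p < length xs \<and> xs ! p = i} = (+) k ` {j. j < length ?ys \<and> ?ys ! j = i}"
    (is "?L = _ ` ?R")
  proof (intro set_eqI iffI)
    fix p
    assume "p \<in> ?L"
    then have "p - k \<in> ?R" "p = k + (p - k)"
      by auto
    then show "p \<in> (+) k ` ?R"
      by blast
  qed auto
  then show ?thesis
    by (simp add: count_list_conv_card card_image)
qed

lemma nth_le_iff_less_length_filter:
  fixes cs :: "'a :: linorder list"
  assumes "sorted cs" and "k < length cs"
  shows "cs ! k \<le> p \<longleftrightarrow> k < length (filter (\<lambda>c. c \<le> p) cs)"
  using assms
proof (induction cs arbitrary: k)
  case (Cons c cs)
  have "filter (\<lambda>c. c \<le> p) cs = []" if "\<not> c \<le> p"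
    using that Cons.prems by (auto simp: filter_empty_conv)
  moreover have "c \<le> cs ! j" if "j < length cs" for j
    using that Cons.prems by auto
  ultimately show ?case
    using Cons by (cases k) (auto simp: not_le intro: less_le_trans)
qed simp

text \<open>A cut at gap \<open>c\<close> lies in front of bead \<open>p\<close> iff
  \<open>c \<le> p\<close>. Hence the number of such cuts is the index of the piece containing
  \<open>p\<close>, and \<open>F p\<close> is the owner of that bead.\<close>

lemma beads_received_eq_card:
  assumes cs: "sorted cs" "\<And>c. c \<in> set cs \<Longrightarrow> c \<le> length w"
    and owner: "\<And>p. p < length w \<Longrightarrow> al ! length (filter (\<lambda>c. c \<le> p) cs) = F p"
  shows "beads_received w cs al t i = card {p. p < length w \<and> w ! p = i \<and> F p = t}"
proof -
  define q where "q p = length (filter (\<lambda>c. c \<le> p) cs)" for p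
  define e where "e = 0 # cs @ [length w]"
  define B where "B j = {p. p < length w \<and> w ! p = i \<and> q p = j}" for j
  have q: "q p \<le> length cs" for p
    by (simp add: q_def)
  have piece: "count_list (piece w cs j) i = card (B j)" if j: "j \<le> length cs" for j
  proof -
    have "e ! j \<le> p \<longleftrightarrow> j \<le> q p" for p
      using j nth_le_iff_less_length_filter [OF cs(1), of "j - 1" p]
      by (cases j) (auto simp: e_def nth_append q_def)
    moreover have "p < e ! Suc j \<longleftrightarrow> q p \<le> j" if "p < length w" for p
    proof (cases "j < length cs")
      case True
      then show ?thesis
        using nth_le_iff_less_length_filter [OF cs(1), of j p] by (auto simp: e_def nth_append q_def not_le not_less)
    next
      case False
      then show ?thesis
        using that j q [of p] by (simp add: e_def nth_append)
    qed
    ultimately have "{p. e ! j \<le> p \<and> p < e ! Suc j \<and> p < length w \<and> w ! p = i} = B j"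
      by (auto simp: B_def)
    then show ?thesis
      unfolding piece_def Let_def e_def [symmetric] count_list_take_drop by simp
  qed
  have "beads_received w cs al t i = (\<Sum>j | j \<le> length cs \<and> al ! j = t. card (B j))"
    unfolding beads_received_def by (rule sum.cong) (auto simp: piece)
  also have "\<dots> = card (\<Union>j\<in>{j. j \<le> length cs \<and> al ! j = t}. B j)"
    by (rule card_UN_disjoint [symmetric]) (auto simp: B_def)
  also have "(\<Union>j\<in>{j. j \<le> length cs \<and> al ! j = t}. B j) = {p. p < length w \<and> w ! p = i \<and> F p = t}"
    using q owner by (auto simp: B_def q_def)
  finally show ?thesis .
qed

text \<open>At the gap \<open>Suc j\<close> exactly \<open>h j\<close> cuts are made while a lazy
  walk leads from \<open>V j\<close> to \<open>V (Suc j)\<close>. The intermediate vertices own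
  empty pieces. As \<open>h j\<close> may exceed the Hamming distance, the total number of cuts can
  be adjusted.\<close>

lemma cuts_along_walk:
  fixes V :: "nat \<Rightarrow> bool list"
  assumes len: "\<And>j. length (V j) = d" and h: "\<And>j. hamming (V j) (V (Suc j)) \<le> h j"
  shows "\<exists>cs al. sorted cs \<and> set cs \<subseteq> {0<..m} \<and> length cs = (\<Sum>j<m. h j) \<and>
    length al = length cs + 1 \<and> last al = V m \<and> set al \<subseteq> {v. length v = d} \<and>
    successively (\<lambda>u v. hamming u v \<le> 1) al \<and>
    (\<forall>p\<le>m. al ! length (filter (\<lambda>c. c \<le> p) cs) = V p)"
proof (induction m)
  case 0
  show ?case
    by (intro exI [of _ "[]"] exI [of _ "[V 0]"]) (simp add: len)
next
  case (Suc m)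
  then obtain cs al where cs: "sorted cs" "set cs \<subseteq> {0<..m}" "length cs = (\<Sum>j<m. h j)"
    and al: "length al = length cs + 1" "last al = V m" "set al \<subseteq> {v. length v = d}"
      "successively (\<lambda>u v. hamming u v \<le> 1) al"
    and owner: "\<And>p. p \<le> m \<Longrightarrow> al ! length (filter (\<lambda>c. c \<le> p) cs) = V p"
    by auto
  obtain us where us: "length us = h m" "last (V m # us) = V (Suc m)" "set us \<subseteq> {v. length v = d}"
    "successively (\<lambda>u v. hamming u v \<le> 1) (V m # us)"
    using lazy_walk [OF len len h] by blast
  let ?cs = "cs @ replicate (h m) (Suc m)" and ?al = "al @ us"
  have "al \<noteq> []"
    using al(1) by auto
  then have last: "last ?al = V (Suc m)"
    using us(2) al(2) by (auto simp: last_append split: if_splits)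
  have "?al ! length (filter (\<lambda>c. c \<le> p) ?cs) = V p" if p: "p \<le> Suc m" for p
  \<comment> \<open>The new cuts all lie at \<open>Suc m\<close>: bead \<open>Suc m\<close> is
    behind every cut and belongs to the last piece, whereas earlier beads do not see the new
    cuts.\<close>
  proof (cases "p = Suc m")
    case True
    have "filter (\<lambda>c. c \<le> Suc m) ?cs = ?cs"
      using cs(2) by (intro filter_True) auto
    then have "length (filter (\<lambda>c. c \<le> p) ?cs) = length ?al - 1"
      using True al(1) us(1) by simp
    then show ?thesis
      using last \<open>al \<noteq> []\<close> True by (simp add: last_conv_nth)
  next
    case False
    then have "filter (\<lambda>c. c \<le> p) ?cs = filter (\<lambda>c. c \<le> p) cs"
      using p by simp
    moreover have "length (filter (\<lambda>c. c \<le> p) cs) < length al"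
      using al(1) by (simp add: le_imp_less_Suc)
    ultimately show ?thesis
      using owner [of p] p False by (simp only: nth_append) simp
  qed
  moreover have "sorted ?cs"
    using cs by (auto simp: sorted_append)
  moreover have "successively (\<lambda>u v. hamming u v \<le> 1) ?al"
    using al(2,4) us(4) \<open>al \<noteq> []\<close> by (auto simp: successively_append_iff successively_Cons)
  ultimately show ?case
    using cs al us last by (intro exI [of _ ?cs] exI [of _ ?al]) auto
qed

theorem theorem5p1:
  fixes d r n :: nat
    and T :: "'t set" and place :: "'t \<Rightarrow> bool list"
    and a :: "nat \<Rightarrow> nat" and w :: "nat list"
  assumes "d \<ge> 1" and "r = 2 ^ d"
    and "card T = r"
    and "bij_betw place T (cube_vertices d)"
    and "set w \<subseteq> {1..n}"
    and "\<forall>i\<in>{1..n}. count_list w i = r * a i"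
  shows "\<exists>cs al. length cs = (r - 1) * n \<and>
           fair_splitting w {1..n} a T cs al \<and> binary_allocation d place al"
proof (cases "w = []")
  case True
  obtain t where t: "t \<in> T"
    using assms(2,3) by fastforce
  \<comment> \<open>Without beads every \<open>a i\<close> is 0, and all cuts are made at the
    conventional gap 0 with a single owner.\<close>
  let ?cs = "replicate ((r - 1) * n) 0" and ?al = "replicate ((r - 1) * n + 1) t"
  have "beads_received w ?cs ?al s i = a i" if "i \<in> {1..n}" for s i
  proof -
    have "a i = 0"
      using assms(2,6) that True by simp
    then show ?thesis
      using True by (subst beads_received_eq_card [where F = "\<lambda>_. t"]) auto
  qed
  then have "fair_splitting w {1..n} a T ?cs ?al"
    using t True by (auto simp: fair_splitting_def necklace_splitting_def gaps_def simp del: replicate.simps)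
  moreover have "binary_allocation d place ?al"
    by (simp add: binary_allocation_def del: replicate.simps)
  ultimately show ?thesis
    by (intro exI [of _ ?cs] exI [of _ ?al]) simp
next
  case False
  \<comment> \<open>As \<open>d \<ge> 1\<close>, every kind has an even number of beads, so a
    nonempty necklace has at least two and possesses a genuine gap. The last bead is
    \<open>Suc m\<close>.\<close>
  obtain m where m: "length w = Suc (Suc m)"
  proof -
    obtain i where i: "i \<in> set w"
      using False by (cases w) auto
    then have "count_list w i \<noteq> 0"
      by (simp add: count_list_0_iff)
    moreover have "even (count_list w i)"
      using i assms(1,2,5,6) by auto
    moreover have "count_list w i \<le> length w"
      by (rule count_le_length)
    ultimately have "length w \<noteq> 0" "length w \<noteq> 1"
      by (auto simp: le_Suc_eq)
    then show ?thesis
      using that by (metis One_nat_def not0_implies_Suc)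
  qed
  have "count_list w i = 2 ^ d * a i" if "i \<in> {1..n}" for i
    using assms(2,6) that by simp
  from cube_colouring [OF finite_atLeastAtMost assms(5) this]
  obtain V :: "nat \<Rightarrow> bool list" where len: "\<And>j. length (V j) = d"
    and V: "\<And>i v. i \<in> {1..n} \<Longrightarrow> length v = d \<Longrightarrow>
      card {j. j < length w \<and> w ! j = i \<and> V j = v} = a i"
    and "(\<Sum>j | Suc j < length w. hamming (V j) (V (Suc j))) \<le> (2 ^ d - 1) * card {1..n}"
    by blast
  then have changes: "(\<Sum>j | Suc j < length w. hamming (V j) (V (Suc j))) \<le> (r - 1) * n"
    using assms(2) by simp
  define H where "H = (\<Sum>j<Suc m. hamming (V j) (V (Suc j)))"
  \<comment> \<open>The cuts missing from the exact number \<open>(r - 1) * n\<close> are all made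
    at gap 1, where the walk rests during the surplus steps.\<close>
  define h where "h j = hamming (V j) (V (Suc j)) + (if j = 0 then (r - 1) * n - H else 0)" for j
  have "{j. Suc j < length w} = {..<Suc m}"
    using m by auto
  then have "H \<le> (r - 1) * n"
    using changes by (simp add: H_def)
  moreover have "(\<Sum>j<Suc m. h j) = H + ((r - 1) * n - H)"
    unfolding h_def H_def sum.distrib by simp
  ultimately have sum: "(\<Sum>j<Suc m. h j) = (r - 1) * n"
    by simp
  obtain cs vs where cs: "sorted cs" "set cs \<subseteq> {0<..Suc m}" "length cs = (r - 1) * n"
    and vs: "length vs = length cs + 1" "set vs \<subseteq> {v. length v = d}"
      "successively (\<lambda>u v. hamming u v \<le> 1) vs"
    and owner: "\<And>p. p \<le> Suc m \<Longrightarrow> vs ! length (filter (\<lambda>c. c \<le> p) cs) = V p"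
    using cuts_along_walk [of V d h "Suc m", OF len] unfolding sum by (auto simp: h_def)
  define g where "g = inv_into T place"
  have g: "g v \<in> T" "place (g v) = v" if "length v = d" for v
    using assms(4) that unfolding g_def cube_vertices_def
    by (auto simp: bij_betw_def inv_into_into f_inv_into_f)
  have "beads_received w cs (map g vs) t i = a i" if t: "t \<in> T" and i: "i \<in> {1..n}" for t i
  proof -
    have place: "length (place t) = d"
      using assms(4) t by (auto simp: bij_betw_def cube_vertices_def)
    have "g v = t \<longleftrightarrow> v = place t" if "length v = d" for v
      using g [OF that] t assms(4) by (auto simp: g_def bij_betw_def)
    then have "{p. p < length w \<and> w ! p = i \<and> g (V p) = t} = {p. p < length w \<and> w ! p = i \<and> V p = place t}"
      using len by auto
    moreover have "beads_received w cs (map g vs) t i = card {p. p < length w \<and> w ! p = i \<and> g (V p) = t}"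
    proof (rule beads_received_eq_card)
      show "c \<le> length w" if "c \<in> set cs" for c
        using that cs(2) m by auto
      show "map g vs ! length (filter (\<lambda>c. c \<le> p) cs) = g (V p)" if "p < length w" for p
        using that m vs(1) owner [of p] by (simp add: le_imp_less_Suc)
    qed (rule cs(1))
    ultimately show ?thesis
      using V [OF i place] by simp
  qed
  moreover have "set cs \<subseteq> gaps w"
    using cs(2) m False by (auto simp: gaps_def)
  moreover have "set (map g vs) \<subseteq> T"
    using vs(2) g by auto
  ultimately have "fair_splitting w {1..n} a T cs (map g vs)"
    using cs(1) vs(1) by (simp add: fair_splitting_def necklace_splitting_def)
  moreover have "binary_allocation d place (map g vs)"
    unfolding binary_allocation_def
  proof (intro allI impI)
    fix j
    assume j: "Suc j < length (map g vs)"
    then have len': "length (vs ! j) = d" "length (vs ! Suc j) = d"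
      using vs(2) by (auto simp: subset_iff)
    have "hamming (vs ! j) (vs ! Suc j) \<le> 1"
      using vs(3) j by (simp add: successively_conv_nth)
    then have "vs ! j = vs ! Suc j \<or> cube_edge d (vs ! j) (vs ! Suc j)"
      using hamming_eq_0 [of "vs ! j" "vs ! Suc j"] cube_edge_iff [OF len'] len' by linarith
    then show "map g vs ! j = map g vs ! Suc j \<or> cube_edge d (place (map g vs ! j)) (place (map g vs ! Suc j))"
      using j g(2) [OF len'(1)] g(2) [OF len'(2)] by auto
  qed
  ultimately show ?thesis
    using cs(3) by blast
qed

end
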